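(* Let $\alpha_0,\alpha_1,\beta_0,\beta_1,\gamma_0,\gamma_1$ be $6$ arbitrary parameters, and assume that the $8$ coefficients $c_m$ of the monic polynomial $P_8(z)=z^8+\sum_{m=0}^{7}c_m z^m$ are expressed as follows in terms of them: $$c_7=4\alpha_1,$$ $$c_6=4\alpha_0+6\alpha_1^2+2\beta_1,$$ $$c_5=12\alpha_0\alpha_1+4\alpha_1^3+6\alpha_1\beta_1,$$ $$c_4=6\alpha_0\left[\alpha_0+2\alpha_1^2+\beta_1\right]+\alpha_1^2\left[\alpha_1^2+6\beta_1\right]+2\beta_0+\beta_1^2+\gamma_1,$$ $$c_3=4\alpha_0\alpha_1\left[3\alpha_0+\alpha_1^2+3\beta_1\right]+2\alpha_1\left[2\beta_0+\alpha_1^2\beta_1+\beta_1^2+\gamma_1\right],$$ $$c_2=2\alpha_0\left\{2\alpha_0^2+3\alpha_0\alpha_1^2+2\beta_0+3\left[\alpha_0+\alpha_1^2\right]\beta_1+\beta_1^2\right\}+2\alpha_1^2\beta_0+\left[2\beta_0+\alpha_1^2\beta_1\right]\beta_1+\left[2\alpha_0+\alpha_1^2+\beta_1\right]\gamma_1,$$ $$c_1=\alpha_1\left\{2\alpha_0\left[2\alpha_0^2+2\beta_0+(3\alpha_0+\beta_1)\beta_1\right]+2\beta_0\beta_1+(2\alpha_0+\beta_1)\gamma_1\right\},$$ $$c_0=\alpha_0\left\{\alpha_0^3+\alpha_0\left[2\beta_0+2\alpha_0\beta_1+\beta_1^2\right]+2\beta_0\beta_1+(\alpha_0+\beta_1)\gamma_1\right\}+\beta_0(\beta_0+\gamma_1)+\gamma_0.$$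 Then the $8$ roots of $P_8$ are the $8$ numbers $z_{\lambda\mu\nu}$ ($\lambda=1,2$, $\mu=1,2$, $\nu=1,2$) defined as follows in terms of the $6$ parameters: for each $\mu,\nu\in\{1,2\}$, the numbers $z_{1\mu\nu},z_{2\mu\nu}$ are the $2$ roots of the quadratic equation in $z$ $$z^2+\alpha_1 z+\alpha_0=y_{\mu\nu},$$ where, for each $\nu\in\{1,2\}$, the numbers $y_{1\nu},y_{2\nu}$ are the $2$ roots of the quadratic equation in $y$ $$y^2+\beta_1 y+\beta_0=x_\nu,$$ and $x_1,x_2$ are the $2$ roots of the quadratic equation in $x$ $$x^2+\gamma_1 x+\gamma_0=0.$$
   Context: All parameters, coefficients and roots are complex numbers, and roots are counted with multiplicity: the $N$ zeros $z_n$ of a monic polynomial $P_N$ of degree $N$ are the numbers such that $P_N(z)=\prod_{n=1}^{N}(z-z_n)=z^N+\sum_{m=0}^{N-1}c_m z^m$. Here $N=8$. *)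

theory Defs
  imports Complex_Main "HOL-Computational_Algebra.Polynomial"
begin

definition monic_poly :: "nat \<Rightarrow> (nat \<Rightarrow> complex) \<Rightarrow> complex poly" where
  "monic_poly N c = monom 1 N + (\<Sum>m<N. monom (c m) m)"

text \<open>The family \<open>z\<close>, indexed by the finite set \<open>I\<close>, lists the zeros of the monic polynomial
  \<open>P\<close> with multiplicity; a zero of multiplicity \<open>k\<close> occurs at \<open>k\<close> indices.\<close>
definition are_zeros :: "'i set \<Rightarrow> ('i \<Rightarrow> complex) \<Rightarrow> complex poly \<Rightarrow> bool" where
  "are_zeros I z P \<longleftrightarrow> finite I \<and> P = (\<Prod>i\<in>I. [:- z i, 1:])"

text \<open>Both roots, with multiplicity, of the equation \<open>t\<^sup>2 + b t + a = w\<close> in \<open>t\<close>.\<close>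
definition are_quadratic_roots ::
    "(nat \<Rightarrow> complex) \<Rightarrow> complex \<Rightarrow> complex \<Rightarrow> complex \<Rightarrow> bool" where
  "are_quadratic_roots t b a w \<longleftrightarrow> are_zeros {1, 2} t ([:a, b, 1:] - [:w:])"

end

theory Submission
  imports Defs
begin

text \<open>
  The proof rests on the fact that the polynomial is a threefold composition of quadratics. Write
  \<open>A = z\<^sup>2 + \<alpha>1 z + \<alpha>0\<close>, \<open>B = y\<^sup>2 + \<beta>1 y + \<beta>0\<close> and
  \<open>C = x\<^sup>2 + \<gamma>1 x + \<gamma>0\<close>; the eight prescribed coefficients are exactly those of
  \<open>C(B(A(z)))\<close> (lemma \<open>monic_poly_8_eq_nested_quadratics\<close>).

  A factorization of a quadratic persists when a polynomial is substituted for its unknown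
  (lemma \<open>quadratic_roots_prod_pcompose\<close>). Hence \<open>C(B(A))\<close> is the product of
  \<open>B(A) - x\<^sub>\<nu>\<close> over \<open>\<nu>\<close>, each of these factors is the product of
  \<open>A - y\<^sub>\<mu>\<^sub>\<nu>\<close> over \<open>\<mu>\<close>, and each of those is the product of the linear
  polynomials \<open>z - z\<^sub>l\<^sub>\<mu>\<^sub>\<nu>\<close> over \<open>l\<close>. These are identities of
  polynomials, so a repeated root is counted with its multiplicity.
\<close>

text \<open>Composition with a fixed inner polynomial \<open>p\<close> is a ring homomorphism, so it carries the
  factorization of the quadratic into linear factors to one with factors \<open>p - t\<^sub>i\<close>.\<close>
lemma quadratic_roots_prod_pcompose:
  assumes "are_quadratic_roots t b a w"
  shows "(\<Prod>i\<in>{1, 2}. p - [:t i:]) = [:a, b, 1:] \<circ>\<^sub>p p - [:w:]"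
proof -
  have "[:a, b, 1:] - [:w:] = (\<Prod>i\<in>{1, 2}. [:- t i, 1:])"
    using assms by (simp add: are_quadratic_roots_def are_zeros_def)
  then have "([:a, b, 1:] - [:w:]) \<circ>\<^sub>p p = (\<Prod>i\<in>{1, 2}. [:- t i, 1:]) \<circ>\<^sub>p p"
    by (rule arg_cong)
  moreover have "[:- t i, 1:] \<circ>\<^sub>p p = p - [:t i:]" for i
    by (simp add: pcompose_pCons minus_pCons flip: diff_conv_add_uminus)
  ultimately show ?thesis
    by (simp only: pcompose_diff pcompose_prod pcompose_const)
qed

lemma monic_poly_8_eq_nested_quadratics:
  fixes \<alpha>0 \<alpha>1 \<beta>0 \<beta>1 \<gamma>0 \<gamma>1 :: complex
    and c :: "nat \<Rightarrow> complex"
  assumes "c 7 = 4 * \<alpha>1"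
    and "c 6 = 4 * \<alpha>0 + 6 * \<alpha>1^2 + 2 * \<beta>1"
    and "c 5 = 12 * \<alpha>0 * \<alpha>1 + 4 * \<alpha>1^3 + 6 * \<alpha>1 * \<beta>1"
    and "c 4 = 6 * \<alpha>0 * (\<alpha>0 + 2 * \<alpha>1^2 + \<beta>1) + \<alpha>1^2 * (\<alpha>1^2 + 6 * \<beta>1)
               + 2 * \<beta>0 + \<beta>1^2 + \<gamma>1"
    and "c 3 = 4 * \<alpha>0 * \<alpha>1 * (3 * \<alpha>0 + \<alpha>1^2 + 3 * \<beta>1)
               + 2 * \<alpha>1 * (2 * \<beta>0 + \<alpha>1^2 * \<beta>1 + \<beta>1^2 + \<gamma>1)"
    and "c 2 = 2 * \<alpha>0 * (2 * \<alpha>0^2 + 3 * \<alpha>0 * \<alpha>1^2 + 2 * \<beta>0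
                          + 3 * (\<alpha>0 + \<alpha>1^2) * \<beta>1 + \<beta>1^2)
               + 2 * \<alpha>1^2 * \<beta>0 + (2 * \<beta>0 + \<alpha>1^2 * \<beta>1) * \<beta>1
               + (2 * \<alpha>0 + \<alpha>1^2 + \<beta>1) * \<gamma>1"
    and "c 1 = \<alpha>1 * (2 * \<alpha>0 * (2 * \<alpha>0^2 + 2 * \<beta>0 + (3 * \<alpha>0 + \<beta>1) * \<beta>1)
                     + 2 * \<beta>0 * \<beta>1 + (2 * \<alpha>0 + \<beta>1) * \<gamma>1)"
    and "c 0 = \<alpha>0 * (\<alpha>0^3 + \<alpha>0 * (2 * \<beta>0 + 2 * \<alpha>0 * \<beta>1 + \<beta>1^2)
                     + 2 * \<beta>0 * \<beta>1 + (\<alpha>0 + \<beta>1) * \<gamma>1)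
               + \<beta>0 * (\<beta>0 + \<gamma>1) + \<gamma>0"
  shows "monic_poly 8 c = [:\<gamma>0, \<gamma>1, 1:] \<circ>\<^sub>p ([:\<beta>0, \<beta>1, 1:] \<circ>\<^sub>p [:\<alpha>0, \<alpha>1, 1:])"
proof -
  have "monic_poly 8 c = [:c 0, c 1, c 2, c 3, c 4, c 5, c 6, c 7, 1:]"
    by (simp add: monic_poly_def eval_nat_numeral monom_Suc monom_0)
  also have "\<dots> = [:\<gamma>0, \<gamma>1, 1:] \<circ>\<^sub>p ([:\<beta>0, \<beta>1, 1:] \<circ>\<^sub>p [:\<alpha>0, \<alpha>1, 1:])"
    unfolding assms by (simp add: pcompose_pCons algebra_simps power2_eq_square eval_nat_numeral)
  finally show ?thesis .
qed

theorem mainTheorem1: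
  fixes \<alpha>0 \<alpha>1 \<beta>0 \<beta>1 \<gamma>0 \<gamma>1 :: complex
    and c :: "nat \<Rightarrow> complex"
    and x :: "nat \<Rightarrow> complex"
    and y :: "nat \<Rightarrow> nat \<Rightarrow> complex"
    and z :: "nat \<Rightarrow> nat \<Rightarrow> nat \<Rightarrow> complex"
  assumes "c 7 = 4 * \<alpha>1"
    and "c 6 = 4 * \<alpha>0 + 6 * \<alpha>1^2 + 2 * \<beta>1"
    and "c 5 = 12 * \<alpha>0 * \<alpha>1 + 4 * \<alpha>1^3 + 6 * \<alpha>1 * \<beta>1"
    and "c 4 = 6 * \<alpha>0 * (\<alpha>0 + 2 * \<alpha>1^2 + \<beta>1) + \<alpha>1^2 * (\<alpha>1^2 + 6 * \<beta>1)
               + 2 * \<beta>0 + \<beta>1^2 + \<gamma>1"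
    and "c 3 = 4 * \<alpha>0 * \<alpha>1 * (3 * \<alpha>0 + \<alpha>1^2 + 3 * \<beta>1)
               + 2 * \<alpha>1 * (2 * \<beta>0 + \<alpha>1^2 * \<beta>1 + \<beta>1^2 + \<gamma>1)"
    and "c 2 = 2 * \<alpha>0 * (2 * \<alpha>0^2 + 3 * \<alpha>0 * \<alpha>1^2 + 2 * \<beta>0
                          + 3 * (\<alpha>0 + \<alpha>1^2) * \<beta>1 + \<beta>1^2)
               + 2 * \<alpha>1^2 * \<beta>0 + (2 * \<beta>0 + \<alpha>1^2 * \<beta>1) * \<beta>1
               + (2 * \<alpha>0 + \<alpha>1^2 + \<beta>1) * \<gamma>1"
    and "c 1 = \<alpha>1 * (2 * \<alpha>0 * (2 * \<alpha>0^2 + 2 * \<beta>0 + (3 * \<alpha>0 + \<beta>1) * \<beta>1)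
                     + 2 * \<beta>0 * \<beta>1 + (2 * \<alpha>0 + \<beta>1) * \<gamma>1)"
    and "c 0 = \<alpha>0 * (\<alpha>0^3 + \<alpha>0 * (2 * \<beta>0 + 2 * \<alpha>0 * \<beta>1 + \<beta>1^2)
                     + 2 * \<beta>0 * \<beta>1 + (\<alpha>0 + \<beta>1) * \<gamma>1)
               + \<beta>0 * (\<beta>0 + \<gamma>1) + \<gamma>0"
    and "are_quadratic_roots x \<gamma>1 \<gamma>0 0"
    and "\<And>\<nu>. \<nu> \<in> {1, 2} \<Longrightarrow> are_quadratic_roots (\<lambda>\<mu>. y \<mu> \<nu>) \<beta>1 \<beta>0 (x \<nu>)"
    and "\<And>\<mu> \<nu>. \<mu> \<in> {1, 2} \<Longrightarrow> \<nu> \<in> {1, 2} \<Longrightarrow>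
           are_quadratic_roots (\<lambda>l. z l \<mu> \<nu>) \<alpha>1 \<alpha>0 (y \<mu> \<nu>)"
  shows "are_zeros ({1, 2} \<times> {1, 2} \<times> {1, 2}) (\<lambda>(l, \<mu>, \<nu>). z l \<mu> \<nu>) (monic_poly 8 c)"
proof -
  let ?A = "[:\<alpha>0, \<alpha>1, 1:]" and ?B = "[:\<beta>0, \<beta>1, 1:]" and ?C = "[:\<gamma>0, \<gamma>1, 1:]"
  let ?I = "{1, 2} :: nat set"
  have "monic_poly 8 c = ?C \<circ>\<^sub>p (?B \<circ>\<^sub>p ?A) - [:0:]"
    using monic_poly_8_eq_nested_quadratics[OF assms(1-8)] by simp
  also have "\<dots> = (\<Prod>\<nu>\<in>?I. ?B \<circ>\<^sub>p ?A - [:x \<nu>:])"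
    by (rule quadratic_roots_prod_pcompose[OF assms(9), symmetric])
  also have "\<dots> = (\<Prod>\<nu>\<in>?I. \<Prod>\<mu>\<in>?I. ?A - [:y \<mu> \<nu>:])"
    by (rule prod.cong[OF refl], rule quadratic_roots_prod_pcompose[OF assms(10), symmetric])
  also have "\<dots> = (\<Prod>\<nu>\<in>?I. \<Prod>\<mu>\<in>?I. \<Prod>l\<in>?I. [:- z l \<mu> \<nu>, 1:])"
    using assms(11)
    by (intro prod.cong refl) (simp only: are_quadratic_roots_def are_zeros_def)
  also have "\<dots> = (\<Prod>\<mu>\<in>?I. \<Prod>\<nu>\<in>?I. \<Prod>l\<in>?I. [:- z l \<mu> \<nu>, 1:])"
    by (rule prod.swap)
  also have "\<dots> = (\<Prod>(\<mu>, \<nu>)\<in>?I \<times> ?I. \<Prod>l\<in>?I. [:- z l \<mu> \<nu>, 1:])"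
    by (rule prod.cartesian_product)
  also have "\<dots> = (\<Prod>q\<in>?I \<times> ?I. \<Prod>l\<in>?I. [:- z l (fst q) (snd q), 1:])"
    by (simp add: case_prod_unfold)
  also have "\<dots> = (\<Prod>l\<in>?I. \<Prod>q\<in>?I \<times> ?I. [:- z l (fst q) (snd q), 1:])"
    by (rule prod.swap)
  also have "\<dots> = (\<Prod>i\<in>?I \<times> ?I \<times> ?I. [:- (case i of (l, \<mu>, \<nu>) \<Rightarrow> z l \<mu> \<nu>), 1:])"
    by (simp only: prod.cartesian_product case_prod_unfold)
  finally show ?thesis
    by (simp only: are_zeros_def) simp
qed

end
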